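(* Let $n\ge 2$ and consider the single-source shortest path problem on the complete directed graph $G=(V,E)$ with $|V|=n$, a designated source $s\in V$, and an integer weight assignment $\ell\colon E\to\mathbb{Z}$ (negative weights allowed) with no negative cycles. Consider query/relaxation-based algorithms (defined in the context) that use D-queries, weight queries, edge queries and relaxation updates, and that are correct, i.e. for every such weight assignment, when the computation ends, $D[v]$ equals the distance from $s$ to $v$ for every $v\in V$. (a) There is a constant $c>0$ such that for every $n$ and every deterministic such algorithm $\mathcal{A}$ there is a weight assignment $\ell$ on which the running time of $\mathcal{A}$ is at least $c n^3$. (b) The same $\Omega(n^3)$ lower bound holds for randomized such algorithms: there is a constant $c>0$ such that for every $n$ and every randomized such algorithm $\mathcal{R}$ (a probability distribution over deterministic such algorithms) there is a weight assignment $\ell$ on which the expected running time of $\mathcal{R}$ is at least $c n^3$.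
   Context: Model: each vertex $v$ carries a value $D[v]$ (the D-value). Initially $D[s]=0$ and $D[v]=\ell_{sv}$ for all $v\neq s$. Allowed queries (each returning yes/no): a D-query "$D[u]<D[v]$?" for vertices $u,v$; a weight query "$\ell_{uv}<\ell_{xy}$?" for edges $(u,v),(x,y)$; an edge query "$D[u]+\ell_{uv}<D[v]$?" for an edge $(u,v)$. A relaxation update for an edge $(u,v)$ performs $D[v]\leftarrow\min\{D[v],D[u]+\ell_{uv}\}$. A deterministic algorithm is a (finite) decision tree whose internal nodes are queries (with a "yes" and a "no" child) or relaxation updates (with one child) and whose leaves are relaxation updates; on input $\ell$ it follows the path determined by the query outcomes. Each query or update counts as one step. The running time of an algorithm on $\ell$ is the number of steps performed until every $D[v]$ equals the distance (length of a shortest simple path) from $s$ to $v$ under $\ell$.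
   Formalization: The running time is counted as at least 1 step even when the initial D-values are already the distances; with the plain count the claim fails for n = 2, where the initial D-values are always correct and the running time is always 0. *)

theory Defs
  imports "Graph_Theory.Kuratowski" "HOL-Probability.Probability"
begin

text \<open>
  Graphs are loop-free digraphs whose arcs are pairs of vertices
  (\<^typ>\<open>'v pair_pre_digraph\<close>, viewed as digraphs through \<^const>\<open>with_proj\<close>).  A weight
  assignment is a total function on pairs; only its values on the arcs of the graph matter.
\<close>

type_synonym 'v weights = "'v \<times> 'v \<Rightarrow> int"

definition walk_length :: "'v weights \<Rightarrow> ('v \<times> 'v) list \<Rightarrow> int" where
  "walk_length l p = (\<Sum>e\<leftarrow>p. l e)"

definition no_negative_cycle :: "'v pair_pre_digraph \<Rightarrow> 'v weights \<Rightarrow> bool" where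
  "no_negative_cycle G l \<longleftrightarrow>
     (\<forall>p. pre_digraph.cycle (with_proj G) p \<longrightarrow> 0 \<le> walk_length l p)"

text \<open>Meaningful for finite graphs in which \<open>v\<close> is reachable from \<open>s\<close>, such as complete ones.\<close>

definition distance :: "'v pair_pre_digraph \<Rightarrow> 'v weights \<Rightarrow> 'v \<Rightarrow> 'v \<Rightarrow> int" where
  "distance G l s v = Min {walk_length l p | p. pre_digraph.apath (with_proj G) s p v}"

datatype 'v query =
    D_Query 'v 'v
  | Weight_Query "'v \<times> 'v" "'v \<times> 'v"
  | Edge_Query "'v \<times> 'v"

text \<open>In \<open>Query q Y N\<close>, \<open>Y\<close> is the ``yes'' child and \<open>N\<close> the ``no'' child.\<close>

datatype 'v algorithm =
    Final "'v \<times> 'v"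
  | Relax "'v \<times> 'v" "'v algorithm"
  | Query "'v query" "'v algorithm" "'v algorithm"

fun query_on :: "'v pair_pre_digraph \<Rightarrow> 'v query \<Rightarrow> bool" where
  "query_on G (D_Query u v) \<longleftrightarrow> u \<in> pverts G \<and> v \<in> pverts G"
| "query_on G (Weight_Query e f) \<longleftrightarrow> e \<in> parcs G \<and> f \<in> parcs G"
| "query_on G (Edge_Query e) \<longleftrightarrow> e \<in> parcs G"

primrec algorithm_on :: "'v pair_pre_digraph \<Rightarrow> 'v algorithm \<Rightarrow> bool" where
  "algorithm_on G (Final e) \<longleftrightarrow> e \<in> parcs G"
| "algorithm_on G (Relax e A) \<longleftrightarrow> e \<in> parcs G \<and> algorithm_on G A"
| "algorithm_on G (Query q Y N) \<longleftrightarrow> query_on G q \<and> algorithm_on G Y \<and> algorithm_on G N"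

definition initial_D :: "'v weights \<Rightarrow> 'v \<Rightarrow> 'v \<Rightarrow> int" where
  "initial_D l s v = (if v = s then 0 else l (s, v))"

fun answer :: "'v weights \<Rightarrow> ('v \<Rightarrow> int) \<Rightarrow> 'v query \<Rightarrow> bool" where
  "answer l D (D_Query u v) \<longleftrightarrow> D u < D v"
| "answer l D (Weight_Query e f) \<longleftrightarrow> l e < l f"
| "answer l D (Edge_Query (u, v)) \<longleftrightarrow> D u + l (u, v) < D v"

fun relax :: "'v weights \<Rightarrow> 'v \<times> 'v \<Rightarrow> ('v \<Rightarrow> int) \<Rightarrow> ('v \<Rightarrow> int)" where
  "relax l (u, v) D = D(v := min (D v) (D u + l (u, v)))"

text \<open>
  The successive D-values along the computation path: entry number \<open>t\<close> of the list holds the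
  D-values after \<open>t\<close> steps, entry \<open>0\<close> being the initial ones.
\<close>

primrec D_states :: "'v weights \<Rightarrow> 'v algorithm \<Rightarrow> ('v \<Rightarrow> int) \<Rightarrow> ('v \<Rightarrow> int) list" where
  "D_states l (Final e) D = [D, relax l e D]"
| "D_states l (Relax e A) D = D # D_states l A (relax l e D)"
| "D_states l (Query q Y N) D =
     D # (if answer l D q then D_states l Y D else D_states l N D)"

definition distances_found ::
  "'v pair_pre_digraph \<Rightarrow> 'v \<Rightarrow> 'v weights \<Rightarrow> ('v \<Rightarrow> int) \<Rightarrow> bool" where
  "distances_found G s l D \<longleftrightarrow> (\<forall>v\<in>pverts G. D v = distance G l s v)"

definition correct_algorithm :: "'v pair_pre_digraph \<Rightarrow> 'v \<Rightarrow> 'v algorithm \<Rightarrow> bool" where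
  "correct_algorithm G s A \<longleftrightarrow> algorithm_on G A \<and>
     (\<forall>l. no_negative_cycle G l \<longrightarrow>
        distances_found G s l (last (D_states l A (initial_D l s))))"

text \<open>
  Every computation performs at least one step, so the running time is taken to be at least
  \<open>1\<close>.  This only matters for weights under which the initial D-values already are the
  distances.  On two vertices all weights are of this kind, and a count of \<open>0\<close> would
  make any positive lower bound fail there.  The least index below exists for correct
  algorithms and weights without negative cycles.
\<close>

definition running_time ::
  "'v pair_pre_digraph \<Rightarrow> 'v \<Rightarrow> 'v algorithm \<Rightarrow> 'v weights \<Rightarrow> nat" where
  "running_time G s A l =
     max 1 (LEAST t. t < length (D_states l A (initial_D l s)) \<and>
                     distances_found G s l (D_states l A (initial_D l s) ! t))"

end

theory Submission
  imports Defs
begin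

text \<open>
  The hard instances hide a path \<open>s, v\<^sub>0, u\<^sub>0, v\<^sub>1, u\<^sub>1, \<dots>\<close> with \<open>m\<close> pairs, where \<open>m\<close> is
  proportional to \<open>n\<close>, the \<open>v\<^sub>i\<close> lie in a set \<open>V\<close> and the \<open>u\<^sub>i\<close> outside it.  Large vertex
  potentials fix the answers to all D-queries and weight queries.  When \<open>u\<^sub>i\<close> reaches its distance,
  its edges to all unused vertices of \<open>V\<close> become improving alike, and which of these vertices is
  \<open>v\<^bsub>i+1\<^esub>\<close> shows only in the size of the improvement, which no query reveals.  Hence the pair
  \<open>(v\<^bsub>i+1\<^esub>, u\<^bsub>i+1\<^esub>)\<close> is learnt only by a step on that very edge, among about \<open>m\<^sup>2\<close> candidates.

  A secret on which a decision tree succeeds within \<open>T\<close> steps is determined by the \<open>m\<close> times at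
  which it steps on the secret pairs, so there are at most \<open>T choose m\<close> such secrets.  For
  \<open>T = m\<^sup>3 / 6\<close> this is at most half of all secrets.  Averaging over the secrets, and exchanging this
  average with the expectation over the random choice of the tree, gives both bounds.
\<close>

section \<open>Weights that hide a path\<close>

locale hidden_path =
  fixes s :: nat and V :: "nat set" and m :: nat
  assumes s_notin: "s \<notin> V" and m_pos: "1 \<le> m"
begin

text \<open>The hidden path has reduced length \<open>- gain i\<close> up to
  \<open>v\<^sub>i\<close>, since each pair edge costs \<open>m\<close> and the hub edges on it cost
  \<open>0\<close>. The offset \<open>m + 1\<close> keeps the gains up to index \<open>m\<close> at
  least \<open>m\<close>, so that no harmless value \<open>- i\<close> falls below
  \<open>- gain i\<close> and the decoy weights \<open>gain i - int i\<close> stay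
  nonnegative.\<close>

definition gain :: "nat \<Rightarrow> int" where
  "gain i = (int m + 1 - int i) * int m"

lemma gain_Suc: "gain (Suc i) = gain i - int m"
  by (simp add: gain_def algebra_simps)

lemma gain_antimono: "i \<le> k \<Longrightarrow> gain k \<le> gain i"
  by (simp add: gain_def mult_right_mono)

lemma gain_ge: "i \<le> m \<Longrightarrow> int m \<le> gain i"
  using gain_antimono[of i m] by (simp add: gain_def)

lemma gain_pos: "i \<le> m \<Longrightarrow> 0 < gain i"
  using gain_ge[of i] m_pos by linarith

definition hub_index :: "(nat \<times> nat) list \<Rightarrow> nat \<Rightarrow> nat" where
  "hub_index p a = (LEAST i. i < length p \<and> snd (p ! i) = a)"

text \<open>
  \<open>p\<close> lists the secret pairs \<open>(v\<^sub>i, u\<^sub>i)\<close>, counted from \<open>0\<close>; the shortest path is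
  \<open>s, v\<^sub>0, u\<^sub>0, v\<^sub>1, u\<^sub>1, \<dots>\<close>.  Reduced weights are measured relative to vertex heights, so that
  reduced D-values start at \<open>0\<close>, except for \<open>- gain 0\<close> at \<open>v\<^sub>0\<close>.  Once \<open>u\<^sub>i\<close> is at its
  distance \<open>- gain (i + 1)\<close>, it lowers every unused vertex of \<open>V\<close> to the harmless value
  \<open>- (i + 1)\<close> and only the next vertex of the path to \<open>- gain (i + 1)\<close>; no query tells the two apart.
  A harmless value is too large to be of use through a pair edge, whose weight is \<open>m\<close>.
\<close>

definition wt :: "(nat \<times> nat) list \<Rightarrow> nat weights" where
  "wt p = (\<lambda>(a, b).
     if b = s then gain 0
     else if a = s then (if p \<noteq> [] \<and> b = fst (p ! 0) then - gain 0 else 0)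
     else if a \<in> V then (if (a, b) \<in> set p then int m else gain 0)
     else if b \<in> V \<and> a \<in> snd ` set p then
       (let i = Suc (hub_index p a) in
        if i < length p \<and> b = fst (p ! i) then 0 else gain i - int i)
     else gain 0)"

definition valid :: "(nat \<times> nat) list \<Rightarrow> bool" where
  "valid p \<longleftrightarrow> length p \<le> m \<and> distinct (map fst p) \<and> distinct (map snd p) \<and>
     fst ` set p \<subseteq> V \<and> snd ` set p \<inter> insert s V = {}"

lemma valid_take: "valid p \<Longrightarrow> valid (take j p)"
  by (auto simp: valid_def take_map[symmetric] dest!: in_set_takeD)

lemma valid_fst: "valid p \<Longrightarrow> i < length p \<Longrightarrow> fst (p ! i) \<in> V"
  by (auto simp: valid_def)

lemma valid_snd: "valid p \<Longrightarrow> i < length p \<Longrightarrow> snd (p ! i) \<notin> V \<and> snd (p ! i) \<noteq> s"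
  unfolding valid_def using nth_mem[of i p] by fastforce

lemma fst_eq_iff: "valid p \<Longrightarrow> i < length p \<Longrightarrow> k < length p \<Longrightarrow> fst (p ! i) = fst (p ! k) \<longleftrightarrow> i = k"
  using nth_eq_iff_index_eq[of "map fst p" i k] by (auto simp: valid_def)

lemma snd_eq_iff: "valid p \<Longrightarrow> i < length p \<Longrightarrow> k < length p \<Longrightarrow> snd (p ! i) = snd (p ! k) \<longleftrightarrow> i = k"
  using nth_eq_iff_index_eq[of "map snd p" i k] by (auto simp: valid_def)

lemma hub_index_snd: "valid p \<Longrightarrow> i < length p \<Longrightarrow> hub_index p (snd (p ! i)) = i"
  unfolding hub_index_def by (rule Least_equality) (auto simp: snd_eq_iff)

lemma wt_into_s: "wt p (a, s) = gain 0"
  by (simp add: wt_def)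

lemma wt_from_s:
  "b \<noteq> s \<Longrightarrow> wt p (s, b) = (if p \<noteq> [] \<and> b = fst (p ! 0) then - gain 0 else 0)"
  by (simp add: wt_def)

lemma wt_from_V:
  "a \<in> V \<Longrightarrow> b \<noteq> s \<Longrightarrow> wt p (a, b) = (if (a, b) \<in> set p then int m else gain 0)"
  using s_notin by (auto simp: wt_def)

lemma wt_from_hub:
  assumes "valid p" "i < length p" "b \<in> V"
  shows "wt p (snd (p ! i), b) =
    (if Suc i < length p \<and> b = fst (p ! Suc i) then 0 else gain (Suc i) - int (Suc i))"
  using assms s_notin valid_snd[OF assms(1,2)] by (auto simp: wt_def Let_def hub_index_snd)

lemma wt_otherwise:
  "a \<notin> V \<Longrightarrow> a \<noteq> s \<Longrightarrow> b \<noteq> s \<Longrightarrow> b \<notin> V \<or> a \<notin> snd ` set p \<Longrightarrow> wt p (a, b) = gain 0"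
  by (auto simp: wt_def)

lemma wt_nonneg:
  assumes "valid p" "a \<noteq> s" shows "0 \<le> wt p (a, b)"
proof (cases "b \<in> V \<and> a \<notin> V \<and> a \<in> snd ` set p")
  case True
  then obtain i where i: "i < length p" "a = snd (p ! i)" by (auto simp: in_set_conv_nth)
  have "Suc i \<le> m" using i assms by (auto simp: valid_def)
  then have "int (Suc i) \<le> gain (Suc i)" using gain_ge[of "Suc i"] by linarith
  then show ?thesis using wt_from_hub[OF assms(1) i(1), of b] True i(2) by (auto split: if_splits)
next
  case False
  then show ?thesis using assms gain_pos[of 0] by (auto simp: wt_def)
qed

lemma wt_bounds:
  assumes "valid p" shows "\<bar>wt p e\<bar> \<le> gain 0"
proof -
  obtain a b where e: "e = (a, b)" by fastforce
  have "gain (Suc i) \<le> gain 0" for i by (rule gain_antimono) simp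
  then have "gain (Suc i) - int (Suc i) \<le> gain 0" for i by (smt (verit) of_nat_0_le_iff)
  then have "wt p e \<le> gain 0"
    using e gain_ge[of 0] gain_pos[of 0] by (auto simp: wt_def Let_def simp del: of_nat_Suc)
  moreover have "- gain 0 \<le> wt p (s, b)"
    using gain_pos[of 0] by (auto simp: wt_def)
  ultimately show ?thesis using e wt_nonneg[OF assms, of a b] gain_pos[of 0] by fastforce
qed

section \<open>States that a known prefix allows\<close>

text \<open>
  A state \<open>d\<close> holds the reduced D-values as far as the known prefix of the secret determines
  them: the value \<open>- j\<close> at the next vertex \<open>fst (p ! j)\<close> of the path stands for the actual value
  \<open>- gain j\<close>, which is put in by \<open>reveal\<close>.
\<close>

definition admissible :: "(nat \<times> nat) list \<Rightarrow> nat \<Rightarrow> int \<Rightarrow> bool" where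
  "admissible p x y \<longleftrightarrow>
     (if x = s then y = 0
      else if x \<in> V then (- int (length p) \<le> y \<and> y \<le> 0) \<or> (\<exists>i<length p. x = fst (p ! i) \<and> y = - gain i)
      else y = 0 \<or> (\<exists>i<length p. x = snd (p ! i) \<and> y = - gain (Suc i)))"

definition reveal :: "(nat \<times> nat) list \<Rightarrow> nat \<Rightarrow> (nat \<Rightarrow> int) \<Rightarrow> nat \<Rightarrow> int" where
  "reveal p j d x = (if j < length p \<and> x = fst (p ! j) \<and> d x = - int j then - gain j else d x)"

lemma admissible_bounds:
  assumes "valid p" "admissible p x y" shows "- gain 0 \<le> y \<and> y \<le> 0"
proof -
  have "int (length p) \<le> gain 0" using assms(1) gain_ge[of 0] by (auto simp: valid_def)
  moreover have "gain i \<le> gain 0 \<and> 0 \<le> gain i \<and> gain (Suc i) \<le> gain 0 \<and> 0 \<le> gain (Suc i)"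
    if "i < length p" for i
    using that assms(1) gain_antimono[of 0 i] gain_antimono[of 0 "Suc i"]
      gain_pos[of i] gain_pos[of "Suc i"] by (auto simp: valid_def)
  ultimately show ?thesis
    using assms(2) gain_pos[of 0] unfolding admissible_def by (fastforce split: if_splits)
qed

lemma reveal_bounds:
  assumes "valid p" "j \<le> length p" "admissible (take j p) x (d x)"
  shows "- gain 0 \<le> reveal p j d x \<and> reveal p j d x \<le> 0"
proof -
  have "gain j \<le> gain 0" "0 < gain j"
    using assms gain_antimono[of 0 j] gain_pos[of j] by (auto simp: valid_def)
  with admissible_bounds[OF valid_take[OF assms(1)] assms(3)] show ?thesis
    by (auto simp: reveal_def)
qed

text \<open>All values lie between \<open>- gain 0\<close> and \<open>0\<close>, so arcs of weight
  \<open>gain 0\<close> are idle. From \<open>s\<close> only the arc to \<open>v\<^sub>0\<close> can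
  improve. A pair edge costs \<open>m\<close>, which absorbs any harmless value, so its tail must
  carry \<open>- gain i\<close>. A hub edge helps only from a hub already at
  \<open>- gain (Suc i)\<close>, and it produces that value again or the harmless
  \<open>- int (Suc i)\<close>.\<close>

lemma admissible_relax:
  assumes p: "valid p" and ab: "a \<noteq> b"
    and d: "admissible p a (d a)" "admissible p b (d b)"
  shows "admissible p b (min (d b) (d a + wt p (a, b)))"
proof -
  have bd: "- gain 0 \<le> d a" "d a \<le> 0" "- gain 0 \<le> d b" "d b \<le> 0"
    using admissible_bounds[OF p d(1)] admissible_bounds[OF p d(2)] by auto
  have len: "length p \<le> m" using p by (simp add: valid_def)
  consider (idle) "d b \<le> d a + wt p (a, b)" | (upd) "d a + wt p (a, b) < d b" by linarith
  then show ?thesis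
  proof cases
    case idle
    then show ?thesis using d(2) by (simp add: min_def)
  next
    case upd
    have bs: "b \<noteq> s" using upd bd wt_into_s[of p a] by auto
    have nonidle: "wt p (a, b) < gain 0" using upd bd by linarith
    show ?thesis
    proof (cases "a = s")
      case True
      have da: "d a = 0" using d(1) True by (simp add: admissible_def)
      have "p \<noteq> [] \<and> b = fst (p ! 0)" and w: "wt p (a, b) = - gain 0"
        using upd bd wt_from_s[OF bs, of p] True da by (auto split: if_splits)
      moreover have "b \<in> V" using calculation valid_fst[OF p, of 0] by auto
      ultimately show ?thesis using upd da bs by (auto simp: admissible_def min_def)
    next
      case as: False
      show ?thesis
      proof (cases "a \<in> V")
        case True
        have w: "wt p (a, b) = int m" and "(a, b) \<in> set p"
          using wt_from_V[OF True bs, of p] nonidle by (auto split: if_splits)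
        then obtain i where i: "i < length p" "p ! i = (a, b)" by (auto simp: in_set_conv_nth)
        have "\<exists>k<length p. a = fst (p ! k) \<and> d a = - gain k"
          using d(1) True as upd w len bd by (auto simp: admissible_def)
        then obtain k where "k < length p" "a = fst (p ! k)" "d a = - gain k" by auto
        with i fst_eq_iff[OF p i(1), of k] have "d a = - gain i" by auto
        moreover have "b \<notin> V" using valid_snd[OF p i(1)] i by auto
        ultimately show ?thesis using upd w i bs by (auto simp: admissible_def min_def gain_Suc intro!: exI[of _ i])
      next
        case False
        have bV: "b \<in> V" and "a \<in> snd ` set p"
          using wt_otherwise[OF False as bs, of p] nonidle by auto
        then obtain i where i: "i < length p" "a = snd (p ! i)" by (auto simp: in_set_conv_nth)
        have im: "Suc i \<le> m" using i len by simp
        have "d a = 0 \<or> (\<exists>k<length p. a = snd (p ! k) \<and> d a = - gain (Suc k))"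
          using d(1) False as by (simp add: admissible_def)
        then have da: "d a = 0 \<or> d a = - gain (Suc i)"
          using i snd_eq_iff[OF p i(1)] by metis
        have w: "wt p (a, b) = (if Suc i < length p \<and> b = fst (p ! Suc i) then 0
            else gain (Suc i) - int (Suc i))"
          using wt_from_hub[OF p i(1) bV] i by simp
        have "int (Suc i) \<le> gain (Suc i)" using gain_ge[OF im] im by linarith
        then have "d a = - gain (Suc i)" using da upd w bd by (auto split: if_splits)
        then show ?thesis using upd w bV bs i by (auto simp: admissible_def min_def split: if_splits)
      qed
    qed
  qed
qed

section \<open>Indistinguishability of the secrets that share a prefix\<close>

text \<open>
  Indistinguishability: unless the step concerns the next secret pair, it has the same effect for
  all secrets that extend the prefix \<open>take j p\<close>.
\<close>

lemma relax_reveal_aux: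
  assumes p: "valid p" and j: "j \<le> length p" and ab: "a \<noteq> b"
    and ne: "j < length p \<Longrightarrow> (a, b) \<noteq> p ! j"
    and d: "\<And>x. admissible (take j p) x (d x)"
  defines "q \<equiv> take j p" and "D \<equiv> reveal p j d"
  shows "(D a + wt p (a, b) < D b \<longleftrightarrow> d a + wt q (a, b) < d b) \<and>
    min (D b) (D a + wt p (a, b)) = reveal p j (d(b := min (d b) (d a + wt q (a, b)))) b"
proof (cases "j < length p")
  case False
  then have "q = p" "D = d" using j by (auto simp: q_def D_def reveal_def)
  with False show ?thesis by (simp add: reveal_def)
next
  case jl: True
  let ?v = "fst (p ! j)"
  have q: "valid q" using p valid_take q_def by simp
  have len: "length p \<le> m" using p by (simp add: valid_def)
  have lq: "length q = j" using jl by (simp add: q_def)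
  have qi: "q ! i = p ! i" if "i < j" for i using that by (simp add: q_def)
  have bd: "- gain 0 \<le> d x" "d x \<le> 0" for x
    using admissible_bounds[OF q] d unfolding q_def by auto
  have Bd: "- gain 0 \<le> D x" "D x \<le> 0" for x
    using reveal_bounds[OF p j, of x d] d[of x] unfolding D_def by auto
  have Deq: "D x = d x" if "x \<noteq> ?v" for x using that by (simp add: D_def reveal_def)
  have Dv: "D ?v = (if d ?v = - int j then - gain j else d ?v)" using jl by (simp add: D_def reveal_def)
  have vV: "?v \<in> V" using valid_fst[OF p jl] .
  have dv: "- int j \<le> d ?v"
  proof -
    have "\<not> (\<exists>i<j. ?v = fst (q ! i))" using jl qi by (auto simp: fst_eq_iff[OF p])
    then show ?thesis using d[of ?v] vV s_notin lq unfolding admissible_def q_def[symmetric]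
      by (auto split: if_splits)
  qed
  have unused: "d (snd (p ! i)) = 0" if "j \<le> i" "i < length p" for i
  proof -
    have "\<not> (\<exists>k<j. snd (p ! i) = snd (q ! k))" using that qi by (auto simp: snd_eq_iff[OF p])
    then show ?thesis using d[of "snd (p ! i)"] valid_snd[OF p that(2)] lq
      unfolding admissible_def q_def[symmetric] by (auto split: if_splits)
  qed
  have idle: ?thesis if "D b \<le> D a + wt p (a, b)" "d b \<le> d a + wt q (a, b)"
    using that by (simp add: min_def D_def reveal_def)
  have same_state: ?thesis if "wt p (a, b) = wt q (a, b)" "a \<noteq> ?v" "b \<noteq> ?v"
    using that Deq by (simp add: reveal_def)
  have top: ?thesis if "wt p (a, b) = gain 0" "wt q (a, b) = gain 0"
    by (rule idle) (use that bd Bd in smt)+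
  show ?thesis
  proof (cases "b = s")
    case True
    then show ?thesis using top wt_into_s by blast
  next
    case bs: False
    show ?thesis
    proof (cases "a = s")
      case as: True
      have da: "d a = 0" "D a = 0" using d[of s] as vV s_notin Deq[of s] by (auto simp: admissible_def)
      consider (zero) "j = 0" "b = ?v" | (same) "j > 0" "b = fst (p ! 0)" | (no) "b \<noteq> fst (p ! 0)"
        by (cases "j = 0") auto
      then show ?thesis
      proof cases
        case zero
        \<comment> \<open>Here \<open>0\<close> is the marked value \<open>- int j\<close>, so the
          start vertex of the path carries \<open>- gain 0\<close> from the outset and its arc from
          \<open>s\<close> is idle in both views.\<close>
        have "d b = 0" using zero dv bd(2)[of b] by auto
        then have "D b = - gain 0" using Dv zero by simp
        moreover have "wt q (a, b) = 0" "wt p (a, b) = - gain 0"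
          using wt_from_s[OF bs] as zero jl lq by auto
        ultimately show ?thesis using da \<open>d b = 0\<close> by (intro idle) auto
      next
        case same
        have "b \<noteq> ?v" using jl same fst_eq_iff[OF p, of 0 j] by fastforce
        moreover have "wt p (a, b) = wt q (a, b)"
          using wt_from_s[OF bs] as same jl lq qi[of 0] by auto
        moreover have "a \<noteq> ?v" using as vV s_notin by auto
        ultimately show ?thesis by (intro same_state)
      next
        case no
        then have "wt q (a, b) = 0" "wt p (a, b) = 0"
          using wt_from_s[OF bs] as lq qi[of 0] by (auto split: if_splits)
        then show ?thesis using da bd(2)[of b] Bd(2)[of b] by (intro idle) auto
      qed
    next
      case as: False
      show ?thesis
      proof (cases "a \<in> V")
        case aV: True
        show ?thesis
        proof (cases "(a, b) \<in> set p")
          case True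
          then obtain i where i: "i < length p" "p ! i = (a, b)" by (auto simp: in_set_conv_nth)
          have bV: "b \<notin> V" using valid_snd[OF p i(1)] i by auto
          have "i \<noteq> j" using ne[OF jl] i by auto
          then consider "i < j" | "j < i" by linarith
          then show ?thesis
          proof cases
            case 1
            have "(a, b) \<in> set q" using 1 i qi[of i] lq by (metis nth_mem)
            then have "wt p (a, b) = wt q (a, b)" using wt_from_V[OF aV bs] True by simp
            moreover have "a \<noteq> ?v" using fst_eq_iff[OF p i(1) jl] i 1 by auto
            moreover have "b \<noteq> ?v" using bV vV by auto
            ultimately show ?thesis by (rule same_state)
          next
            case 2
            have "(a, b) \<notin> set q"
            proof
              assume "(a, b) \<in> set q"
              then obtain k where "k < j" "q ! k = (a, b)" using lq by (auto simp: in_set_conv_nth)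
              then show False using qi[of k] fst_eq_iff[OF p i(1), of k] i 2 by auto
            qed
            then have wq: "wt q (a, b) = gain 0" using wt_from_V[OF aV bs] by simp
            have wp: "wt p (a, b) = int m" using wt_from_V[OF aV bs] True by simp
            have av: "a \<noteq> ?v" using fst_eq_iff[OF p i(1) jl] i 2 by auto
            have "a = fst (p ! i)" using i by simp
            then have "\<not> (\<exists>k<j. a = fst (q ! k))"
              using i(1) 2 qi by (auto simp: fst_eq_iff[OF p])
            then have "- int j \<le> d a" using d[of a] aV as lq
              unfolding admissible_def q_def[symmetric] by (auto split: if_splits)
            \<comment> \<open>A later pair edge has its low weight \<open>m\<close> only under the
              full secret, but its tail carries at least \<open>- int j\<close> with
              \<open>j < m\<close>, so relaxing it achieves nothing.\<close>
            then have "D b \<le> D a + wt p (a, b)" using wp Deq[OF av] Bd(2)[of b] len jl by linarith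
            moreover have "d b \<le> d a + wt q (a, b)" using wq bd(2)[of b] bd(1)[of a] by linarith
            ultimately show ?thesis by (rule idle)
          qed
        next
          case False
          then have "(a, b) \<notin> set q" by (auto simp: q_def dest: in_set_takeD)
          then show ?thesis using top wt_from_V[OF aV bs] False by simp
        qed
      next
        case aV: False
        show ?thesis
        proof (cases "b \<in> V \<and> a \<in> snd ` set p")
          case False
          then have "b \<notin> V \<or> a \<notin> snd ` set q" by (auto simp: q_def dest: in_set_takeD)
          then show ?thesis using top wt_otherwise[OF aV as bs] False by blast
        next
          case True
          then obtain i where bV: "b \<in> V" and i: "i < length p" "a = snd (p ! i)"
            by (auto simp: in_set_conv_nth)
          have im: "Suc i \<le> m" using i len by simp
          have gi: "int m \<le> gain (Suc i)" using gain_ge[OF im] .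
          have wp: "wt p (a, b) = (if Suc i < length p \<and> b = fst (p ! Suc i) then 0
              else gain (Suc i) - int (Suc i))"
            using wt_from_hub[OF p i(1) bV] i by simp
          have Da: "D a = d a" using aV vV by (intro Deq) auto
          show ?thesis
          proof (cases "j \<le> i")
            case True
            have da: "d a = 0" using unused True i by simp
            have "a \<notin> snd ` set q"
            proof
              assume "a \<in> snd ` set q"
              then obtain k where "k < j" "a = snd (q ! k)" using lq by (auto simp: in_set_conv_nth)
              then show False using qi[of k] snd_eq_iff[OF p i(1), of k] i True by auto
            qed
            then have "wt q (a, b) = gain 0" using wt_otherwise[OF aV as bs] by simp
            moreover have "0 \<le> wt p (a, b)" using wp gi im by auto
            ultimately show ?thesis using da Da bd(2)[of b] Bd(2)[of b] gain_pos[of 0]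
              by (intro idle) auto
          next
            case ij: False
            then have ij: "i < j" by simp
            have wq: "wt q (a, b) = (if Suc i < j \<and> b = fst (p ! Suc i) then 0
                else gain (Suc i) - int (Suc i))"
              using wt_from_hub[OF q, of i b] bV i ij lq qi by (auto simp: q_def)
            have "d a = 0 \<or> (\<exists>k<j. a = snd (q ! k) \<and> d a = - gain (Suc k))"
              using d[of a] aV as lq unfolding admissible_def q_def[symmetric] by auto
            then have da: "d a = 0 \<or> d a = - gain (Suc i)"
              using i ij jl snd_eq_iff[OF p i(1)] qi by (metis less_trans)
            show ?thesis
            proof (cases "d a = 0")
              case True
              moreover have "0 \<le> wt p (a, b)" "0 \<le> wt q (a, b)" using wp wq gi im by auto
              ultimately show ?thesis using Da bd(2)[of b] Bd(2)[of b] by (intro idle) auto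
            next
              case False
              then have da: "d a = - gain (Suc i)" using da by simp
              show ?thesis
              proof (cases "b = ?v")
                case bv: False
                have "b = fst (p ! Suc i) \<Longrightarrow> Suc i < length p \<Longrightarrow> Suc i < j"
                  using bv ij by (metis Suc_lessI)
                then have "wt p (a, b) = wt q (a, b)" using wp wq jl by auto
                moreover have "a \<noteq> ?v" using aV vV by auto
                ultimately show ?thesis using bv by (intro same_state)
              next
                case bv: True
                have wq: "wt q (a, b) = gain (Suc i) - int (Suc i)"
                  using wq bv fst_eq_iff[OF p jl, of "Suc i"] jl by auto
                show ?thesis
                proof (cases "Suc i = j")
                  case True
                  \<comment> \<open>The decisive case: the last known hub relaxes the next vertex of
                    the path. The full secret yields \<open>- gain j\<close> and the prefix yields
                    the decoy value \<open>- int j\<close>, which \<open>reveal\<close> translates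
                    into each other.\<close>
                  then have "wt p (a, b) = 0" using wp jl bv by simp
                  then show ?thesis using da Da wq True dv bv Dv gi im jl
                    by (auto simp: reveal_def min_def)
                next
                  case False
                  have wp: "wt p (a, b) = gain (Suc i) - int (Suc i)"
                    using wp False bv fst_eq_iff[OF p jl, of "Suc i"] by auto
                  \<comment> \<open>An earlier hub offers \<open>- int (Suc i)\<close>, which is
                    above \<open>- int j\<close> and not below \<open>- gain j\<close>. It can
                    neither create the marked value nor improve on the revealed one.\<close>
                  have "int (Suc i) < int j" "int (Suc i) \<le> gain j"
                    using ij False gain_ge[of j] jl len im by auto
                  then show ?thesis using da Da wq wp bv Dv dv jl
                    by (auto simp: reveal_def min_def)
                qed
              qed
            qed
          qed
        qed
      qed
    qed
  qed
qed

definition admissible_state :: "(nat \<times> nat) list \<Rightarrow> (nat \<Rightarrow> int) \<Rightarrow> bool" where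
  "admissible_state p d \<longleftrightarrow> valid p \<and> (\<forall>x. admissible p x (d x))"

lemma admissible_state_relax:
  assumes "admissible_state p d" "fst e \<noteq> snd e"
  shows "admissible_state p (relax (wt p) e d)"
  using assms admissible_relax[of p "fst e" "snd e" d]
  by (cases e) (auto simp: admissible_state_def)

lemma relax_reveal:
  assumes p: "valid p" and j: "j \<le> length p" and e: "fst e \<noteq> snd e"
    and ne: "j < length p \<Longrightarrow> p ! j \<noteq> e" and d: "admissible_state (take j p) d"
  shows "relax (wt p) e (reveal p j d) = reveal p j (relax (wt (take j p)) e d)"
    and "answer (wt p) (reveal p j d) (Edge_Query e) \<longleftrightarrow> answer (wt (take j p)) d (Edge_Query e)"
proof -
  obtain a b where ab: "e = (a, b)" by fastforce
  have *: "(reveal p j d a + wt p (a, b) < reveal p j d b \<longleftrightarrow> d a + wt (take j p) (a, b) < d b) \<and>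
    min (reveal p j d b) (reveal p j d a + wt p (a, b)) =
      reveal p j (d(b := min (d b) (d a + wt (take j p) (a, b)))) b"
    using e ne d ab by (intro relax_reveal_aux[OF p j]) (auto simp: admissible_state_def)
  show "answer (wt p) (reveal p j d) (Edge_Query e) \<longleftrightarrow> answer (wt (take j p)) d (Edge_Query e)"
    using * ab by simp
  show "relax (wt p) e (reveal p j d) = reveal p j (relax (wt (take j p)) e d)"
    using * ab by (auto simp: fun_eq_iff reveal_def)
qed

text \<open>Re-reads a state after pair \<open>j\<close> becomes known: \<open>- gain j\<close> at
  \<open>fst (p ! j)\<close> is now an admissible value. The vertex after it has so far received
  nothing below \<open>- int j\<close>, hence not the mark \<open>- int (Suc j)\<close>, and there
  is nothing further to reveal.\<close>

lemma admissible_state_reveal: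
  assumes p: "valid p" and j: "j < length p" and d: "admissible_state (take j p) d"
  shows "admissible_state (take (Suc j) p) (reveal p j d)" and "reveal p (Suc j) (reveal p j d) = reveal p j d"
proof -
  have len: "length p \<le> m" using p by (simp add: valid_def)
  have vV: "fst (p ! j) \<in> V" "fst (p ! j) \<noteq> s" using valid_fst[OF p j] s_notin by auto
  have adm: "admissible (take j p) x (d x)" for x using d by (simp add: admissible_state_def)
  have "admissible (take (Suc j) p) x (reveal p j d x)" for x
    using adm[of x] vV j less_Suc_eq
    by (auto simp: admissible_def reveal_def less_Suc_eq split: if_splits)
  then show "admissible_state (take (Suc j) p) (reveal p j d)"
    using valid_take[OF p] by (simp add: admissible_state_def)
  show "reveal p (Suc j) (reveal p j d) = reveal p j d"
  proof
    fix x
    have "reveal p j d x \<noteq> - int (Suc j)" if "Suc j < length p" "x = fst (p ! Suc j)"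
    proof -
      have xV: "x \<in> V" "x \<noteq> s" using that valid_fst[OF p that(1)] s_notin by auto
      have "\<not> (\<exists>i<j. x = fst (p ! i))" "x \<noteq> fst (p ! j)"
        using that fst_eq_iff[OF p that(1)] by auto
      then show ?thesis using adm[of x] xV that by (auto simp: admissible_def reveal_def)
    qed
    then show "reveal p (Suc j) (reveal p j d) x = reveal p j d x"
      unfolding reveal_def[of p "Suc j"] by auto
  qed
qed

lemma reveal_take: "j < length p \<Longrightarrow> reveal (take (Suc j) p) j d = reveal p j d"
  by (auto simp: reveal_def fun_eq_iff)

section \<open>Potentials that fix the answers to D-queries and weight queries\<close>

text \<open>
  The gaps between heights, and between differences of heights, exceed all variations of reduced
  values and weights, so heights alone decide D-queries and weight queries.
\<close>

definition height :: "nat \<Rightarrow> int" where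
  "height x = 3 ^ x * (2 * gain 0 + 1)"

definition len :: "(nat \<times> nat) list \<Rightarrow> nat weights" where
  "len p = (\<lambda>(a, b). height b - height a + wt p (a, b))"

definition lift :: "(nat \<Rightarrow> int) \<Rightarrow> nat \<Rightarrow> int" where
  "lift d x = height x - height s + d x"

lemma relax_lift: "relax (len p) e (lift d) = lift (relax (wt p) e d)"
  by (cases e) (auto simp: len_def lift_def fun_eq_iff)

lemma answer_edge_lift:
  "answer (len p) (lift d) (Edge_Query e) \<longleftrightarrow> answer (wt p) d (Edge_Query e)"
  by (cases e) (auto simp: len_def lift_def)

text \<open>The simulation starts from the empty prefix with all reduced values \<open>0\<close>. At
  \<open>v\<^sub>0\<close> this is the mark \<open>- int 0\<close>, which \<open>reveal\<close>
  replaces by \<open>- gain 0\<close>.\<close>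

lemma initial_D_len:
  assumes "valid p" shows "initial_D (len p) s = lift (reveal p 0 (\<lambda>_. 0))"
  using valid_fst[OF assms, of 0] s_notin
  by (auto simp: initial_D_def fun_eq_iff lift_def len_def reveal_def wt_from_s)

text \<open>Since \<open>2 * 3 ^ y < 3 ^ Suc y\<close>, the larger exponent can be read off the sum.
  Height differences along two distinct arcs therefore differ; the crossed alternative would make
  both arcs loops.\<close>

lemma sum_powers_of_3_eq:
  fixes a b c d :: nat
  assumes "(3::int) ^ a + 3 ^ b = 3 ^ c + 3 ^ d"
  shows "a = c \<and> b = d \<or> a = d \<and> b = c"
proof -
  have *: "b' = d' \<and> a' = c'"
    if eq: "(3::int) ^ a' + 3 ^ b' = 3 ^ c' + 3 ^ d'" and ord: "a' \<le> b'" "c' \<le> d'"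
    for a' b' c' d' :: nat
  proof -
    have le: "\<not> y < z" if "(3::int) ^ x + 3 ^ y = 3 ^ w + 3 ^ z" "x \<le> y" for x y w z :: nat
    proof
      assume "y < z"
      then have "(3::int) ^ Suc y \<le> 3 ^ z" by (intro power_increasing) auto
      moreover have "(3::int) ^ x \<le> 3 ^ y" using that by (intro power_increasing) auto
      moreover have "(0::int) < 3 ^ w" "(0::int) < 3 ^ y" by auto
      ultimately show False using that(1) unfolding power_Suc by linarith
    qed
    have "b' = d'" using le[OF eq ord(1)] le[OF eq[symmetric] ord(2)] by linarith
    then show ?thesis using eq by simp
  qed
  have "(3::int) ^ b + 3 ^ a = 3 ^ c + 3 ^ d" "(3::int) ^ a + 3 ^ b = 3 ^ d + 3 ^ c"
    "(3::int) ^ b + 3 ^ a = 3 ^ d + 3 ^ c"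
    using assms by linarith+
  from *[OF assms] this[THEN *] show ?thesis
    using linear[of a b] linear[of c d] by blast
qed

fun height_answer :: "nat query \<Rightarrow> bool" where
  "height_answer (D_Query u v) \<longleftrightarrow> height u < height v"
| "height_answer (Weight_Query (a, b) (c, d)) \<longleftrightarrow> height b - height a < height d - height c"
| "height_answer (Edge_Query e) \<longleftrightarrow> False"

text \<open>Distinct multiples of \<open>2 * g + 1\<close> are at least that far apart, whereas two
  perturbations shift the comparison by at most \<open>2 * g\<close>. This is the source of the
  factor in \<open>height\<close>.\<close>

lemma scaled_gap:
  fixes x y g :: int
  assumes "x \<noteq> y" "0 \<le> g" "\<bar>r\<bar> \<le> g" "\<bar>r'\<bar> \<le> g"
  shows "x * (2 * g + 1) + r < y * (2 * g + 1) + r' \<longleftrightarrow> x * (2 * g + 1) < y * (2 * g + 1)"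
proof -
  have *: "u * (2 * g + 1) + (2 * g + 1) \<le> v * (2 * g + 1)" if "u < v" for u v :: int
    using mult_right_mono[of "u + 1" v "2 * g + 1"] that assms(2) by (simp add: algebra_simps)
  from assms(1) consider "x < y" | "y < x" by linarith
  then show ?thesis by cases (use *[of x y] *[of y x] assms in linarith)+
qed

lemma answer_lift:
  assumes q: "\<And>e. q \<noteq> Edge_Query e" and on: "query_on G q"
    and loopless: "\<And>e. e \<in> parcs G \<Longrightarrow> fst e \<noteq> snd e"
    and p: "valid p" and d: "\<And>x. - gain 0 \<le> d x \<and> d x \<le> 0"
  shows "answer (len p) (lift d) q \<longleftrightarrow> height_answer q"
proof -
  have g: "0 \<le> gain 0" using gain_pos[of 0] by simp
  show ?thesis
  proof (cases q)
    case (D_Query u v)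
    show ?thesis
    proof (cases "u = v")
      case False
      then have "(3::int) ^ u \<noteq> 3 ^ v" by simp
      from scaled_gap[OF this g, of "d u" "d v"] d[of u] d[of v] show ?thesis
        by (simp add: D_Query lift_def height_def)
    qed (simp add: D_Query)
  next
    case (Weight_Query e f)
    obtain a b c d where ef: "e = (a, b)" "f = (c, d)" by (metis surj_pair)
    show ?thesis
    proof (cases "e = f")
      case False
      have "a \<noteq> b" "c \<noteq> d" using on loopless[of e] loopless[of f] Weight_Query ef by auto
      then have "(3::int) ^ b - 3 ^ a \<noteq> 3 ^ d - 3 ^ c"
        using sum_powers_of_3_eq[of b c d a] False ef by (auto simp: algebra_simps)
      from scaled_gap[OF this g wt_bounds[OF p, of e] wt_bounds[OF p, of f]] show ?thesis
        by (simp add: Weight_Query len_def ef height_def left_diff_distrib)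
    qed (auto simp: Weight_Query ef)
  qed (use q in auto)
qed

section \<open>Counting the secrets solved within a given number of steps\<close>

text \<open>A necessary condition for success that watches a single vertex: the last hub has a
  negative reduced value. By \<open>distance_len_le\<close> it holds once all distances are
  found.\<close>

definition overtaken :: "(nat \<times> nat) list \<Rightarrow> (nat \<Rightarrow> int) \<Rightarrow> bool" where
  "overtaken p D \<longleftrightarrow> D (snd (last p)) < height (snd (last p)) - height s"

abbreviation reached :: "(nat \<times> nat) list \<Rightarrow> (nat \<Rightarrow> int) \<Rightarrow> bool" where
  "reached p d \<equiv> overtaken p (lift d)"

lemma reached_iff: "reached p d \<longleftrightarrow> d (snd (last p)) < 0"
  by (simp add: overtaken_def lift_def)

definition finished :: "(nat \<times> nat) list \<Rightarrow> nat algorithm \<Rightarrow> (nat \<Rightarrow> int) \<Rightarrow> nat \<Rightarrow> bool" where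
  "finished p A d T \<longleftrightarrow>
     (\<exists>t\<le>T. t < length (D_states (len p) A (lift d)) \<and> overtaken p (D_states (len p) A (lift d) ! t))"

lemma ex_nth_Cons_le_Suc:
  "(\<exists>t\<le>Suc T. t < length (x # xs) \<and> Q ((x # xs) ! t)) \<longleftrightarrow>
     Q x \<or> (\<exists>t\<le>T. t < length xs \<and> Q (xs ! t))"
proof
  assume "\<exists>t\<le>Suc T. t < length (x # xs) \<and> Q ((x # xs) ! t)"
  then obtain t where "t \<le> Suc T" "t < length (x # xs)" "Q ((x # xs) ! t)" by auto
  then show "Q x \<or> (\<exists>t\<le>T. t < length xs \<and> Q (xs ! t))" by (cases t) auto
next
  assume "Q x \<or> (\<exists>t\<le>T. t < length xs \<and> Q (xs ! t))"
  then show "\<exists>t\<le>Suc T. t < length (x # xs) \<and> Q ((x # xs) ! t)"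
  proof
    assume "Q x"
    then show ?thesis by (intro exI[of _ 0]) simp
  next
    assume "\<exists>t\<le>T. t < length xs \<and> Q (xs ! t)"
    then obtain t where "t \<le> T" "t < length xs" "Q (xs ! t)" by blast
    then show ?thesis by (intro exI[of _ "Suc t"]) simp
  qed
qed

lemma finished_0: "finished p A d 0 \<longleftrightarrow> reached p d"
  by (cases A) (auto simp: finished_def)

lemma finished_Final:
  "finished p (Final e) d (Suc T) \<longleftrightarrow> reached p d \<or> reached p (relax (wt p) e d)"
  unfolding finished_def D_states.simps ex_nth_Cons_le_Suc[where Q = "overtaken p"]
  by (auto simp: relax_lift)

lemma finished_Relax:
  "finished p (Relax e A) d (Suc T) \<longleftrightarrow> reached p d \<or> finished p A (relax (wt p) e d) T"
  unfolding finished_def D_states.simps ex_nth_Cons_le_Suc[where Q = "overtaken p"]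
  by (auto simp: relax_lift)

lemma finished_Query:
  "finished p (Query q Y N) d (Suc T) \<longleftrightarrow>
     reached p d \<or> finished p (if answer (len p) (lift d) q then Y else N) d T"
  unfolding finished_def D_states.simps ex_nth_Cons_le_Suc[where Q = "overtaken p"]
  by (auto simp: relax_lift)

text \<open>With a proper prefix known, the last hub is outside that prefix, so its reduced value is
  still \<open>0\<close>.\<close>

lemma not_reached:
  assumes p: "valid p" "length p = m" and j: "j < m" and d: "admissible_state (take j p) d"
  shows "\<not> reached p (reveal p j d)"
proof -
  have m: "m - 1 < length p" and last: "last p = p ! (m - 1)"
    using p m_pos last_conv_nth[of p] by (cases p; auto)+
  let ?u = "snd (p ! (m - 1))"
  have u: "?u \<notin> V" "?u \<noteq> s" using valid_snd[OF p(1) m] by auto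
  have "\<not> (\<exists>k<j. ?u = snd (p ! k))" using snd_eq_iff[OF p(1) m] j p(2) by auto
  moreover have "admissible (take j p) ?u (d ?u)" using d by (simp add: admissible_state_def)
  ultimately have "d ?u = 0" using u j p(2) by (auto simp: admissible_def)
  moreover have "?u \<noteq> fst (p ! j)" using valid_fst[OF p(1), of j] j p(2) u by auto
  ultimately show ?thesis by (simp add: reached_iff last reveal_def)
qed

lemma card_step:
  assumes fin: "finite P"
    and hit: "card {p \<in> P. take (Suc j) p = q @ [e] \<and> X p} \<le> b"
    and miss: "card {p \<in> P. take j p = q \<and> p ! j \<noteq> e \<and> X p} \<le> c"
    and len: "\<And>p. p \<in> P \<Longrightarrow> j < length p"
  shows "card {p \<in> P. take j p = q \<and> X p} \<le> b + c"
proof -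
  have "{p \<in> P. take j p = q \<and> X p} \<subseteq>
    {p \<in> P. take (Suc j) p = q @ [e] \<and> X p} \<union> {p \<in> P. take j p = q \<and> p ! j \<noteq> e \<and> X p}"
    using len by (auto simp: take_Suc_conv_app_nth)
  then have "card {p \<in> P. take j p = q \<and> X p} \<le> card
    ({p \<in> P. take (Suc j) p = q @ [e] \<and> X p} \<union> {p \<in> P. take j p = q \<and> p ! j \<noteq> e \<and> X p})"
    using fin by (intro card_mono) auto
  also have "\<dots> \<le> b + c" using card_Un_le hit miss by (meson add_mono le_trans)
  finally show ?thesis .
qed

lemma card_determined:
  assumes P: "\<And>p. p \<in> P \<Longrightarrow> length p = m" and q: "length q = m"
  shows "card {p \<in> P. take (length q) p = q \<and> X p} \<le> 1"
proof -
  have "{p \<in> P. take (length q) p = q \<and> X p} \<subseteq> {q}"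
  proof
    fix p assume "p \<in> {p \<in> P. take (length q) p = q \<and> X p}"
    then have "length p = length q" "take (length q) p = q" using P q by simp_all
    then show "p \<in> {q}" by (metis order.refl singletonI take_all)
  qed
  then show ?thesis using card_mono[of "{q}"] by fastforce
qed

lemma card_reached:
  assumes P: "\<And>p. p \<in> P \<Longrightarrow> valid p \<and> length p = m"
    and q: "length q \<le> m" "admissible_state q d"
  shows "card {p \<in> P. take (length q) p = q \<and> reached p (reveal p (length q) d)} \<le> T choose (m - length q)"
proof (cases "length q = m")
  case True
  then show ?thesis using card_determined[of P q] P by simp
next
  case False
  have "\<not> reached p (reveal p (length q) d)" if "p \<in> P" "take (length q) p = q" for p
    using not_reached[of p "length q" d] P[OF that(1)] that(2) q False by simp
  then have "{p \<in> P. take (length q) p = q \<and> reached p (reveal p (length q) d)} = {}" by blast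
  then show ?thesis by (metis card.empty le0)
qed

text \<open>If the step hits the next pair, the current values are re-read over the prefix
  \<open>q @ [e]\<close>, in a form \<open>d'\<close> that depends only on \<open>q\<close>,
  \<open>e\<close> and \<open>d\<close>. As \<open>e\<close> is not also the following pair,
  indistinguishability applies to this same step with the longer prefix.\<close>

lemma reveal_hit:
  assumes p: "valid p" "length q < length p" "take (Suc (length q)) p = q @ [e]"
    and d: "admissible_state q d"
  defines "d' \<equiv> reveal (q @ [e]) (length q) d"
  shows "admissible_state (q @ [e]) d'" and "reveal p (length q) d = reveal p (Suc (length q)) d'"
    and "Suc (length q) < length p \<Longrightarrow> p ! Suc (length q) \<noteq> e"
proof -
  have tq: "take (length q) p = q" using arg_cong[OF p(3), of "take (length q)"] by (simp add: min_def)
  have rd: "reveal p (length q) d = d'" using reveal_take[OF p(2), of d] p(3) by (simp add: d'_def)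
  show "admissible_state (q @ [e]) d'"
    using admissible_state_reveal(1)[OF p(1,2), of d] d tq rd p(3) by simp
  show "reveal p (length q) d = reveal p (Suc (length q)) d'"
    using admissible_state_reveal(2)[OF p(1,2), of d] d tq unfolding rd by simp
  have "p ! length q = e" using p(2,3) tq by (simp add: take_Suc_conv_app_nth)
  then show "Suc (length q) < length p \<Longrightarrow> p ! Suc (length q) \<noteq> e"
    using fst_eq_iff[OF p(1), of "Suc (length q)" "length q"] p(2) by auto
qed

text \<open>
  One step on the edge \<open>e\<close> splits the secrets that extend \<open>q\<close> into those that continue with \<open>e\<close> and
  the others; both groups keep a common state, and Pascal's rule adds up the bounds.
\<close>

lemma card_edge_step:
  assumes P: "finite P" "\<And>p. p \<in> P \<Longrightarrow> valid p \<and> length p = m"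
    and q: "length q < m" "admissible_state q d"
    and h: "\<And>q d. admissible_state q d \<Longrightarrow> admissible_state q (h q d)"
    and view: "\<And>p j d. valid p \<Longrightarrow> j \<le> length p \<Longrightarrow> (j < length p \<Longrightarrow> p ! j \<noteq> e) \<Longrightarrow>
      admissible_state (take j p) d \<Longrightarrow>
      h p (reveal p j d) = reveal p j (h (take j p) d) \<and> c p (reveal p j d) = c (take j p) d"
    and F: "\<And>b q d. length q \<le> m \<Longrightarrow> admissible_state q d \<Longrightarrow>
      card {p \<in> P. take (length q) p = q \<and> F b p (reveal p (length q) d)} \<le> T choose (m - length q)"
  shows "card {p \<in> P. take (length q) p = q \<and>
      F (c p (reveal p (length q) d)) p (h p (reveal p (length q) d))} \<le> Suc T choose (m - length q)"
proof -
  let ?j = "length q" and ?q = "q @ [e]" and ?d = "reveal (q @ [e]) (length q) d"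
  let ?X = "\<lambda>p. F (c p (reveal p ?j d)) p (h p (reveal p ?j d))"
  have k: "m - ?j = Suc (m - Suc ?j)" using q by simp
  have hit: "card {p \<in> P. take (Suc ?j) p = ?q \<and> ?X p} \<le> T choose (m - Suc ?j)"
  proof (cases "\<exists>p\<in>P. take (Suc ?j) p = ?q")
    case True
    \<comment> \<open>The shared state is the same for all these secrets; any one of them witnesses
      that it is admissible for the longer prefix.\<close>
    then have d: "admissible_state ?q ?d" using reveal_hit(1)[OF _ _ _ q(2)] P(2) q(1) by fastforce
    have "?X p \<longleftrightarrow> F (c ?q ?d) p (reveal p (Suc ?j) (h ?q ?d))"
      if p: "p \<in> P" "take (Suc ?j) p = ?q" for p
    proof -
      have v: "valid p" "?j < length p" using P(2)[OF p(1)] q by auto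
      note hit = reveal_hit(2,3)[OF v p(2) q(2)]
      show ?thesis using view[of p "Suc ?j" ?d] hit v p(2) d by simp
    qed
    then have "{p \<in> P. take (Suc ?j) p = ?q \<and> ?X p} =
      {p \<in> P. take (length ?q) p = ?q \<and> F (c ?q ?d) p (reveal p (length ?q) (h ?q ?d))}"
      by auto
    then show ?thesis using F[OF _ h[OF d]] q by simp
  next
    case False
    then have "{p \<in> P. take (Suc ?j) p = ?q \<and> ?X p} = {}" by auto
    then show ?thesis by (metis card.empty le0)
  qed
  have "?X p \<longleftrightarrow> F (c q d) p (reveal p ?j (h q d))" if "p \<in> P" "take ?j p = q" "p ! ?j \<noteq> e" for p
    using view[of p ?j d] P(2)[OF that(1)] that q by simp
  then have "{p \<in> P. take ?j p = q \<and> p ! ?j \<noteq> e \<and> ?X p} \<subseteq>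
    {p \<in> P. take ?j p = q \<and> F (c q d) p (reveal p ?j (h q d))}" by auto
  then have "card {p \<in> P. take ?j p = q \<and> p ! ?j \<noteq> e \<and> ?X p} \<le>
    card {p \<in> P. take ?j p = q \<and> F (c q d) p (reveal p ?j (h q d))}"
    using P(1) by (intro card_mono) auto
  also have "\<dots> \<le> T choose (m - ?j)" using F[OF _ h[OF q(2)]] q by simp
  finally show ?thesis
    using card_step[OF P(1) hit] P(2) q unfolding k by (simp add: binomial_Suc_Suc)
qed

lemma card_finished_trivial:
  assumes P: "\<And>p. p \<in> P \<Longrightarrow> valid p \<and> length p = m"
    and q: "length q \<le> m" "admissible_state q d" and triv: "length q = m \<or> T = 0"
  shows "card {p \<in> P. take (length q) p = q \<and> finished p A (reveal p (length q) d) T}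
    \<le> T choose (m - length q)"
  using triv
proof
  assume "length q = m"
  then show ?thesis using card_determined[of P q] P by simp
next
  assume "T = 0"
  then show ?thesis using card_reached[OF P q] by (simp add: finished_0)
qed

text \<open>Induction over the tree for all prefixes, states and time bounds at once, since a step
  may change each of them. The bound counts the ways to place the \<open>m - length q\<close>
  remaining discoveries among \<open>T\<close> steps.\<close>

lemma card_finished:
  assumes P: "finite P" "\<And>p. p \<in> P \<Longrightarrow> valid p \<and> length p = m"
    and loopless: "\<And>e. e \<in> parcs G \<Longrightarrow> fst e \<noteq> snd e"
    and A: "algorithm_on G A" and q: "length q \<le> m" "admissible_state q d"
  shows "card {p \<in> P. take (length q) p = q \<and> finished p A (reveal p (length q) d) T}
    \<le> T choose (m - length q)"
  using A q
proof (induction A arbitrary: q d T)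
  case base: (Final e)
  show ?case
  proof (cases "length q = m \<or> T = 0")
    case True
    show ?thesis by (rule card_finished_trivial[OF P(2) base(2,3) True])
  next
    case False
    then obtain T' where T: "T = Suc T'" and j: "length q < m" using base(2) by (cases T) auto
    have e: "fst e \<noteq> snd e" using base(1) loopless by simp
    have nr: "\<not> reached p (reveal p (length q) d)" if "p \<in> P" "take (length q) p = q" for p
      using not_reached[of p "length q" d] P(2)[OF that(1)] that(2) j base(3) by simp
    have "card {p \<in> P. take (length q) p = q \<and> reached p (relax (wt p) e (reveal p (length q) d))}
      \<le> Suc T' choose (m - length q)"
      \<comment> \<open>A relaxation changes the values through \<open>h\<close> and has no outcome
        to branch on, so \<open>c\<close> is constant.\<close>
      by (rule card_edge_step[where c = "\<lambda>_ _. True" and e = e and h = "\<lambda>p. relax (wt p) e"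
          and F = "\<lambda>_. reached", OF P j base(3)])
        (simp_all add: admissible_state_relax relax_reveal e card_reached[OF P(2)])
    moreover have "{p \<in> P. take (length q) p = q \<and> finished p (Final e) (reveal p (length q) d) T} =
      {p \<in> P. take (length q) p = q \<and> reached p (relax (wt p) e (reveal p (length q) d))}"
      using nr by (auto simp: T finished_Final)
    ultimately show ?thesis by (simp add: T)
  qed
next
  case step: (Relax e A)
  show ?case
  proof (cases "length q = m \<or> T = 0")
    case True
    show ?thesis by (rule card_finished_trivial[OF P(2) step(3,4) True])
  next
    case False
    then obtain T' where T: "T = Suc T'" and j: "length q < m" using step(3) by (cases T) auto
    have e: "fst e \<noteq> snd e" and A: "algorithm_on G A" using step(2) loopless by simp_all
    have nr: "\<not> reached p (reveal p (length q) d)" if "p \<in> P" "take (length q) p = q" for p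
      using not_reached[of p "length q" d] P(2)[OF that(1)] that(2) j step(4) by simp
    have "card {p \<in> P. take (length q) p = q \<and> finished p A (relax (wt p) e (reveal p (length q) d)) T'}
      \<le> Suc T' choose (m - length q)"
      by (rule card_edge_step[where c = "\<lambda>_ _. True" and e = e and h = "\<lambda>p. relax (wt p) e"
          and F = "\<lambda>_ p D. finished p A D T'", OF P j step(4)])
        (simp_all add: admissible_state_relax relax_reveal e step.IH[OF A])
    moreover have "{p \<in> P. take (length q) p = q \<and> finished p (Relax e A) (reveal p (length q) d) T} =
      {p \<in> P. take (length q) p = q \<and> finished p A (relax (wt p) e (reveal p (length q) d)) T'}"
      using nr by (auto simp: T finished_Relax)
    ultimately show ?thesis by (simp add: T)
  qed
next
  case step: (Query x Y N)
  show ?case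
  proof (cases "length q = m \<or> T = 0")
    case True
    show ?thesis by (rule card_finished_trivial[OF P(2) step(4,5) True])
  next
    case False
    then obtain T' where T: "T = Suc T'" and j: "length q < m" using step(4) by (cases T) auto
    have x: "query_on G x" and Y: "algorithm_on G Y" and N: "algorithm_on G N" using step(3) by simp_all
    have nr: "\<not> reached p (reveal p (length q) d)" if "p \<in> P" "take (length q) p = q" for p
      using not_reached[of p "length q" d] P(2)[OF that(1)] that(2) j step(5) by simp
    have IH: "card {p \<in> P. take (length q) p = q \<and>
        finished p (if b then Y else N) (reveal p (length q) d) T'} \<le> T' choose (m - length q)"
      if "length q \<le> m" "admissible_state q d" for b q d
      using step.IH(1)[OF Y that] step.IH(2)[OF N that] by simp
    have eq: "{p \<in> P. take (length q) p = q \<and> finished p (Query x Y N) (reveal p (length q) d) T} =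
      {p \<in> P. take (length q) p = q \<and> finished p
        (if answer (len p) (lift (reveal p (length q) d)) x then Y else N) (reveal p (length q) d) T'}"
      unfolding T finished_Query using nr by blast
    have "card {p \<in> P. take (length q) p = q \<and> finished p
        (if answer (len p) (lift (reveal p (length q) d)) x then Y else N) (reveal p (length q) d) T'}
      \<le> Suc T' choose (m - length q)"
    proof (cases "\<exists>e. x = Edge_Query e")
      case True
      then obtain e where xe: "x = Edge_Query e" by blast
      have e: "fst e \<noteq> snd e" using x loopless xe by simp
      \<comment> \<open>Conversely, an edge query keeps the values and is felt only through its
        outcome \<open>c\<close>, which selects the child.\<close>
      show ?thesis unfolding xe answer_edge_lift
        by (rule card_edge_step[where c = "\<lambda>p D. answer (wt p) D (Edge_Query e)" and e = e
            and h = "\<lambda>_ D. D" and F = "\<lambda>b p D. finished p (if b then Y else N) D T'", OF P j step(5)])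
          (simp_all only: relax_reveal(2) e IH not_False_eq_True simp_thms)
    next
      case no_edge: False
      have "answer (len p) (lift (reveal p (length q) d)) x = height_answer x"
        if p: "p \<in> P" "take (length q) p = q" for p
      proof (rule answer_lift[OF _ x loopless])
        show "valid p" using P(2)[OF p(1)] by simp
        show "- gain 0 \<le> reveal p (length q) d y \<and> reveal p (length q) d y \<le> 0" for y
          using P(2)[OF p(1)] p(2) step(4,5) by (intro reveal_bounds) (simp_all add: admissible_state_def)
      qed (use no_edge in auto)
      then have "{p \<in> P. take (length q) p = q \<and> finished p
          (if answer (len p) (lift (reveal p (length q) d)) x then Y else N) (reveal p (length q) d) T'} =
        {p \<in> P. take (length q) p = q \<and>
          finished p (if height_answer x then Y else N) (reveal p (length q) d) T'}"
        by (intro Collect_cong) (simp cong: conj_cong)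
      then have "card {p \<in> P. take (length q) p = q \<and> finished p
          (if answer (len p) (lift (reveal p (length q) d)) x then Y else N) (reveal p (length q) d) T'}
        \<le> T' choose (m - length q)"
        using IH[OF step(4,5)] by simp
      \<comment> \<open>The answer is common to all secrets, so the query spends a step without
        separating any of them.\<close>
      also have "\<dots> \<le> Suc T' choose (m - length q)"
        by (intro binomial_right_mono) simp
      finally show ?thesis .
    qed
    then show ?thesis unfolding eq unfolding T .
  qed
qed

section \<open>Absence of negative cycles, and the hidden path as an upper bound on a
  distance\<close>

text \<open>Raising the potential of \<open>s\<close> by \<open>gain 0\<close> makes every arc
  weight nonnegative relative to the potential: arcs leaving \<open>s\<close> weigh at least
  \<open>- gain 0\<close>, arcs entering it exactly \<open>gain 0\<close>, and all others are
  nonnegative. The sum then telescopes.\<close>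

lemma walk_length_len_ge:
  assumes "valid p" "pcas a c b"
  shows "height b + (if b = s then gain 0 else 0) - (height a + (if a = s then gain 0 else 0))
    \<le> walk_length (len p) c"
  using assms(2)
proof (induction c arbitrary: a)
  case Nil
  then show ?case by (simp add: walk_length_def)
next
  case (Cons e c)
  obtain x where e: "e = (a, x)" using Cons.prems by (cases e) auto
  have "(if x = s then gain 0 else 0) - (if a = s then gain 0 else 0) \<le> wt p (a, x)"
    using wt_into_s[of p a] wt_nonneg[OF assms(1), of a x] wt_bounds[OF assms(1), of "(a, x)"]
      gain_pos[of 0] by auto
  then show ?case using Cons.IH[of x] Cons.prems e by (simp add: walk_length_def len_def)
qed

lemma no_negative_cycle_len:
  assumes "valid p" shows "no_negative_cycle G (len p)"
  unfolding no_negative_cycle_def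
proof (intro allI impI)
  fix c assume "pre_digraph.cycle (with_proj G) c"
  then obtain u where "pcas u c u"
    by (auto simp: pre_digraph.cycle_def pre_digraph.awalk_def cas_with_proj_eq)
  from walk_length_len_ge[OF assms this] show "0 \<le> walk_length (len p) c" by simp
qed

lemma pcas_snoc: "pcas a (c @ [e]) b \<longleftrightarrow> pcas a c (fst e) \<and> snd e = b"
  by (induction c arbitrary: a) auto

lemma pawalk_verts_snoc: "pcas a c (fst e) \<Longrightarrow> pawalk_verts a (c @ [e]) = pawalk_verts a c @ [snd e]"
  by (induction c arbitrary: a) auto

text \<open>The reduced weights along the path are \<open>- gain 0\<close>, \<open>m\<close>,
  \<open>0\<close>, \<open>m\<close> and so on. Tracking the visited vertices in the induction shows
  that the next two are fresh, which keeps the path simple.\<close>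

lemma hidden_path_exists:
  assumes p: "valid p" and sW: "s \<in> W" and pW: "set p \<subseteq> W \<times> W"
    and arcs: "\<And>a b. a \<in> W \<Longrightarrow> b \<in> W \<Longrightarrow> a \<noteq> b \<Longrightarrow> (a, b) \<in> E"
  shows "j < length p \<Longrightarrow> \<exists>c. pcas s c (snd (p ! j)) \<and> set c \<subseteq> E \<and> distinct (pawalk_verts s c) \<and>
    set (pawalk_verts s c) \<subseteq> insert s (\<Union>i\<le>j. {fst (p ! i), snd (p ! i)}) \<and>
    walk_length (len p) c = height (snd (p ! j)) - height s - gain (Suc j)"
proof (induction j)
  case 0
  let ?v = "fst (p ! 0)" and ?u = "snd (p ! 0)"
  have v: "?v \<in> V" "?v \<noteq> s" and u: "?u \<notin> V" "?u \<noteq> s"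
    using valid_fst[OF p 0] valid_snd[OF p 0] s_notin by auto
  have "?v \<in> W" "?u \<in> W" using pW nth_mem[OF 0] by (auto simp: mem_Times_iff)
  then have "(s, ?v) \<in> E" "(?v, ?u) \<in> E" using arcs sW v u by metis+
  moreover have "wt p (s, ?v) = - gain 0" "wt p (?v, ?u) = int m"
    using wt_from_s[OF v(2), of p] wt_from_V[OF v(1) u(2), of p] 0 by auto
  ultimately show ?case using v u
    by (intro exI[of _ "[(s, ?v), (?v, ?u)]"]) (auto simp: walk_length_def len_def gain_Suc case_prod_unfold)
next
  case (Suc j)
  let ?x = "snd (p ! j)" and ?v = "fst (p ! Suc j)" and ?u = "snd (p ! Suc j)"
  have j: "j < length p" using Suc.prems by simp
  obtain c where c: "pcas s c ?x" "set c \<subseteq> E" "distinct (pawalk_verts s c)"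
      "set (pawalk_verts s c) \<subseteq> insert s (\<Union>i\<le>j. {fst (p ! i), snd (p ! i)})"
      "walk_length (len p) c = height ?x - height s - gain (Suc j)"
    using Suc.IH[OF j] by blast
  have v: "?v \<in> V" "?v \<noteq> s" and u: "?u \<notin> V" "?u \<noteq> s" and x: "?x \<notin> V" "?x \<noteq> s"
    using valid_fst[OF p Suc.prems] valid_snd[OF p Suc.prems] valid_snd[OF p j] s_notin by auto
  have "?v \<in> W" "?u \<in> W" "?x \<in> W"
    using pW nth_mem[OF Suc.prems] nth_mem[OF j] by (auto simp: mem_Times_iff)
  then have E: "(?x, ?v) \<in> E" "(?v, ?u) \<in> E" using arcs v u x by metis+
  have w: "wt p (?x, ?v) = 0" "wt p (?v, ?u) = int m"
    using wt_from_hub[OF p j v(1)] wt_from_V[OF v(1) u(2), of p] Suc.prems by auto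
  have fresh: "?v \<noteq> fst (p ! i)" "?u \<noteq> snd (p ! i)" "?v \<noteq> snd (p ! i)" "?u \<noteq> fst (p ! i)"
    if "i \<le> j" for i
    using that Suc.prems fst_eq_iff[OF p Suc.prems, of i] snd_eq_iff[OF p Suc.prems, of i]
      valid_fst[OF p, of i] valid_snd[OF p, of i] v u by auto
  have vu: "?v \<noteq> ?u" using v u by auto
  have "?v \<notin> set (pawalk_verts s c)" "?u \<notin> set (pawalk_verts s c)"
    using c(4) fresh v(2) u(2) by blast+
  moreover have pc: "pcas s (c @ [(?x, ?v)]) ?v" using c(1) by (simp add: pcas_snoc)
  moreover have verts: "pawalk_verts s ((c @ [(?x, ?v)]) @ [(?v, ?u)]) = pawalk_verts s c @ [?v, ?u]"
    using pawalk_verts_snoc[of s "c @ [(?x, ?v)]" "(?v, ?u)"] pawalk_verts_snoc[of s c "(?x, ?v)"] c(1) pc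
    by simp
  moreover have "pcas s ((c @ [(?x, ?v)]) @ [(?v, ?u)]) ?u"
    unfolding pcas_snoc[of _ "c @ [(?x, ?v)]"] using pc by simp
  moreover have "set (pawalk_verts s c @ [?v, ?u])
      \<subseteq> insert s (\<Union>i\<le>Suc j. {fst (p ! i), snd (p ! i)})"
    using c(4) by (auto simp: atMost_Suc)
  moreover have "walk_length (len p) ((c @ [(?x, ?v)]) @ [(?v, ?u)]) =
      height ?u - height s - gain (Suc (Suc j))"
    using c(5) w by (simp add: walk_length_def len_def gain_Suc case_prod_unfold)
  ultimately show ?case using c(2,3) E vu
    by (intro exI[of _ "(c @ [(?x, ?v)]) @ [(?v, ?u)]"]) (auto simp del: append_assoc)
qed

lemma distance_len_le:
  assumes p: "valid p" "length p = m" and s: "s \<in> pverts G" and pW: "set p \<subseteq> pverts G \<times> pverts G"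
    and G: "complete_digraph n (with_proj G)"
  shows "distance G (len p) s (snd (last p)) < height (snd (last p)) - height s"
proof -
  have arcs: "parcs G = {(u, v). (u, v) \<in> pverts G \<times> pverts G \<and> u \<noteq> v}"
    using G by (simp add: complete_digraph_def)
  have p0: "m - 1 < length p" "last p = p ! (m - 1)" using p m_pos last_conv_nth[of p] by (cases p; auto)+
  obtain c where c: "pcas s c (snd (last p))" "set c \<subseteq> parcs G" "distinct (pawalk_verts s c)"
      "walk_length (len p) c = height (snd (last p)) - height s - gain m"
    using hidden_path_exists[OF p(1) s pW, of "parcs G" "m - 1"] p0 m_pos arcs by auto
  interpret pair_graph G using G by (rule pair_graphI_complete)
  have "pre_digraph.apath (with_proj G) s c (snd (last p))"
    using c s by (simp add: pre_digraph.apath_def pre_digraph.awalk_def)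
  moreover have "finite {walk_length (len p) c | c. pre_digraph.apath (with_proj G) s c (snd (last p))}"
    using apaths_finite[of s "snd (last p)"] by (simp add: Setcompr_eq_image)
  ultimately have "distance G (len p) s (snd (last p)) \<le> walk_length (len p) c"
    unfolding distance_def by (intro Min_le) auto
  then show ?thesis using c(4) gain_pos[of m] by simp
qed

section \<open>The number of secrets and the average running time\<close>

definition instances :: "nat set \<Rightarrow> (nat \<times> nat) list set" where
  "instances W = {p. valid p \<and> length p = m \<and> set p \<subseteq> W \<times> W}"

lemma finite_instances: "finite W \<Longrightarrow> finite (instances W)"
  unfolding instances_def
  by (rule finite_subset[OF _ finite_lists_length_eq[of "W \<times> W" m]]) auto

lemma finished_if_running_time_le:
  assumes G: "complete_digraph n (with_proj G)" and s: "s \<in> pverts G"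
    and A: "correct_algorithm G s A" and p: "p \<in> instances (pverts G)"
    and T: "running_time G s A (len p) \<le> T"
  shows "finished p A (reveal p 0 (\<lambda>_. 0)) T"
proof -
  have v: "valid p" "length p = m" "set p \<subseteq> pverts G \<times> pverts G" using p by (auto simp: instances_def)
  let ?L = "D_states (len p) A (initial_D (len p) s)"
  let ?Q = "\<lambda>t. t < length ?L \<and> distances_found G s (len p) (?L ! t)"
  have ne: "?L \<noteq> []" by (cases A) auto
  have "distances_found G s (len p) (last ?L)"
    using A no_negative_cycle_len[OF v(1)] by (simp add: correct_algorithm_def)
  then have "?Q (length ?L - 1)" using ne by (simp add: last_conv_nth)
  then have Q: "?Q (LEAST t. ?Q t)" by (rule LeastI)
  \<comment> \<open>The maximum with \<open>1\<close> in \<open>running_time\<close> only increases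
    it, so the bound passes to the least index.\<close>
  moreover have "(LEAST t. ?Q t) \<le> T" using T unfolding running_time_def by simp
  moreover have "last p \<in> pverts G \<times> pverts G"
    using v(2,3) m_pos last_in_set[of p] by (cases "p = []") auto
  then have "snd (last p) \<in> pverts G" by (simp add: mem_Times_iff)
  then have "overtaken p (?L ! (LEAST t. ?Q t))"
    using Q distance_len_le[OF v(1,2) s v(3) G] by (simp add: distances_found_def overtaken_def)
  ultimately show ?thesis unfolding finished_def initial_D_len[OF v(1)] by blast
qed

lemma card_running_time_le:
  assumes G: "complete_digraph n (with_proj G)" and s: "s \<in> pverts G"
    and A: "correct_algorithm G s A"
  shows "card {p \<in> instances (pverts G). running_time G s A (len p) \<le> T} \<le> T choose m"
proof -
  have fin: "finite (instances (pverts G))"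
    using G complete_digraph_pair_def[of n G] by (intro finite_instances) simp
  have arcs: "parcs G = {(u, v). (u, v) \<in> pverts G \<times> pverts G \<and> u \<noteq> v}"
    using G by (simp add: complete_digraph_def)
  let ?q = "[] :: (nat \<times> nat) list"
  have adm: "admissible_state ?q (\<lambda>_. 0)" by (simp add: admissible_state_def valid_def admissible_def)
  have "card {p \<in> instances (pverts G). running_time G s A (len p) \<le> T} \<le>
    card {p \<in> instances (pverts G). take (length ?q) p = ?q \<and> finished p A (reveal p (length ?q) (\<lambda>_. 0)) T}"
    using finished_if_running_time_le[OF G s A] fin by (intro card_mono) auto
  also have "\<dots> \<le> T choose (m - length ?q)"
    using A arcs by (intro card_finished[OF fin _ _ _ _ adm]) (auto simp: instances_def correct_algorithm_def)
  finally show ?thesis by simp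
qed

text \<open>The falling factorial has \<open>m\<close> factors, each at least
  \<open>card X - m + 1\<close>, which exceeds \<open>m\<close>.\<close>

lemma card_distinct_lists_ge:
  assumes "finite X" "2 * m \<le> card X"
  shows "m ^ m \<le> card {xs. length xs = m \<and> distinct xs \<and> set xs \<subseteq> X}"
proof -
  have "m ^ m = (\<Prod>i\<in>{card X - m + 1..card X}. m)" using assms by simp
  also have "\<dots> \<le> \<Prod>{card X - m + 1..card X}" using assms by (intro prod_mono) auto
  also have "\<dots> = card {xs. length xs = m \<and> distinct xs \<and> set xs \<subseteq> X}"
    using card_lists_distinct_length_eq[OF assms(1), of m] assms(2) by simp
  finally show ?thesis .
qed

lemma card_instances_ge:
  assumes W: "finite W" "V \<subseteq> W" and cV: "2 * m \<le> card V" and cU: "2 * m \<le> card (W - insert s V)"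
  shows "m ^ (2 * m) \<le> card (instances W)"
proof -
  let ?L = "\<lambda>X. {xs. length xs = m \<and> distinct xs \<and> set xs \<subseteq> X}"
  have fV: "finite V" using W finite_subset by blast
  have "m ^ (2 * m) = m ^ m * m ^ m" by (simp add: power_add mult_2)
  also have "\<dots> \<le> card (?L V) * card (?L (W - insert s V))"
    using cV cU W fV by (intro mult_mono card_distinct_lists_ge) auto
  also have "\<dots> = card (?L V \<times> ?L (W - insert s V))" by (simp add: card_cartesian_product)
  also have "\<dots> = card ((\<lambda>(xs, ys). zip xs ys) ` (?L V \<times> ?L (W - insert s V)))"
    by (intro card_image[symmetric] inj_onI) (auto simp: zip_eq_conv map_fst_zip map_snd_zip)
  also have "\<dots> \<le> card (instances W)"
  proof (intro card_mono finite_instances W(1) image_subsetI)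
    fix z assume "z \<in> ?L V \<times> ?L (W - insert s V)"
    then obtain xs ys where z: "z = (xs, ys)" "length xs = m" "distinct xs" "set xs \<subseteq> V"
      "length ys = m" "distinct ys" "set ys \<subseteq> W - insert s V" by auto
    have "fst ` set (zip xs ys) = set xs" "snd ` set (zip xs ys) = set ys"
      using z by (simp_all flip: set_map)
    moreover have "set (zip xs ys) \<subseteq> W \<times> W"
      using z W(2) by (auto dest: set_zip_leftD set_zip_rightD)
    ultimately show "(\<lambda>(xs, ys). zip xs ys) z \<in> instances W"
      using z by (auto simp: instances_def valid_def)
  qed
  finally show ?thesis .
qed

text \<open>Combines \<open>(T choose m) * fact m <= T ^ m\<close> with
  \<open>m ^ m / fact m <= exp m <= 3 ^ m\<close>. In the constant \<open>6\<close>, the factor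
  \<open>3\<close> pays for the factorial, and the factor \<open>2\<close> gains
  \<open>2 ^ m\<close>, hence at least the required \<open>2\<close>.\<close>

lemma binomial_le:
  assumes "6 * T \<le> m ^ 3"
  shows "2 * (T choose m) \<le> m ^ (2 * m)"
proof -
  have "real m ^ m / fact m \<le> exp (real m)"
  proof -
    have "(\<Sum>k\<in>{m}. real m ^ k /\<^sub>R fact k) \<le> (\<Sum>k. real m ^ k /\<^sub>R fact k)"
      by (intro sum_le_suminf summable_exp_generic) auto
    then show ?thesis by (simp add: exp_def divide_inverse mult.commute)
  qed
  also have "\<dots> = exp 1 ^ m" by (simp flip: exp_of_nat_mult)
  also have "\<dots> \<le> 3 ^ m" using exp_le by (intro power_mono) auto
  finally have f: "real m ^ m \<le> 3 ^ m * fact m" by (simp add: field_simps)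
  have "real (T choose m) * (2 ^ m * real m ^ m) \<le> real (T choose m) * (2 ^ m * (3 ^ m * fact m))"
    using f by (intro mult_left_mono) auto
  also have "\<dots> = 6 ^ m * real ((T choose m) * fact m)"
    using power_mult_distrib[of "2::real" 3 m] by simp
  also have "\<dots> \<le> 6 ^ m * real (T ^ m)"
    using binomial_fact_pow[of T m] by (intro mult_left_mono) (simp_all only: of_nat_le_iff, simp)
  also have "\<dots> = real (6 * T) ^ m" by (simp add: power_mult_distrib)
  also have "\<dots> \<le> real (m ^ 3) ^ m" using assms by (intro power_mono) (simp_all only: of_nat_le_iff of_nat_0_le_iff)
  also have "\<dots> = real m ^ (2 * m) * real m ^ m" by (simp flip: power_mult power_add)
  finally have "real (T choose m) * 2 ^ m \<le> real m ^ (2 * m)" using m_pos by simp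
  moreover have "real (T choose m) * 2 \<le> real (T choose m) * 2 ^ m"
    using m_pos power_increasing[of 1 m "2::real"] by (intro mult_left_mono) auto
  ultimately have "real (2 * (T choose m)) \<le> real (m ^ (2 * m))" by simp
  then show ?thesis by (simp only: of_nat_le_iff)
qed

text \<open>At least half of the secrets need \<open>Suc (m ^ 3 div 6)\<close> steps or more, and
  six times this number exceeds \<open>m ^ 3\<close>. The two factors give
  \<open>12\<close>.\<close>

lemma sum_running_time_ge:
  assumes G: "complete_digraph n (with_proj G)" and s: "s \<in> pverts G"
    and A: "correct_algorithm G s A"
    and V: "V \<subseteq> pverts G" "2 * m \<le> card V" "2 * m \<le> card (pverts G - insert s V)"
  shows "card (instances (pverts G)) * m ^ 3
    \<le> 12 * (\<Sum>p\<in>instances (pverts G). running_time G s A (len p))"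
proof -
  let ?S = "instances (pverts G)" and ?T = "m ^ 3 div 6"
  let ?fast = "{p \<in> ?S. running_time G s A (len p) \<le> ?T}"
  have fin: "finite (pverts G)" using G complete_digraph_pair_def[of n G] by simp
  then have finS: "finite ?S" by (rule finite_instances)
  have "2 * card ?fast \<le> 2 * (?T choose m)" using card_running_time_le[OF G s A] by simp
  also have "\<dots> \<le> m ^ (2 * m)" by (intro binomial_le) simp
  also have "\<dots> \<le> card ?S" using card_instances_ge[OF fin V] .
  finally have "card ?S \<le> 2 * (card ?S - card ?fast)" by simp
  also have "\<dots> = 2 * card (?S - ?fast)" using finS by (simp add: card_Diff_subset)
  finally have "card ?S * m ^ 3 \<le> 2 * card (?S - ?fast) * (6 * Suc ?T)"
    by (rule mult_le_mono) (use dividend_less_times_div[of 6 "m ^ 3"] in simp)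
  also have "\<dots> = 12 * (\<Sum>p\<in>?S - ?fast. Suc ?T)" by (simp add: algebra_simps)
  also have "\<dots> \<le> 12 * (\<Sum>p\<in>?S - ?fast. running_time G s A (len p))"
    by (intro mult_le_mono2 sum_mono) auto
  also have "\<dots> \<le> 12 * (\<Sum>p\<in>?S. running_time G s A (len p))"
    using finS by (intro mult_le_mono2 sum_mono2) auto
  finally show ?thesis .
qed

lemma exists_slow_instance:
  fixes R :: "nat algorithm pmf"
  assumes G: "complete_digraph n (with_proj G)" and s: "s \<in> pverts G"
    and R: "\<And>A. A \<in> set_pmf R \<Longrightarrow> correct_algorithm G s A"
    and V: "V \<subseteq> pverts G" "2 * m \<le> card V" "2 * m \<le> card (pverts G - insert s V)"
  shows "\<exists>l. no_negative_cycle G l \<and>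
    ennreal (real m ^ 3 / 12) \<le> (\<integral>\<^sup>+ A. of_nat (running_time G s A l) \<partial>measure_pmf R)"
proof -
  let ?S = "instances (pverts G)" and ?c = "ennreal (real m ^ 3 / 12)"
  define E where "E p = (\<integral>\<^sup>+ A. of_nat (running_time G s A (len p)) \<partial>measure_pmf R)" for p
  have fin: "finite (pverts G)" using G complete_digraph_pair_def[of n G] by simp
  then have finS: "finite ?S" by (rule finite_instances)
  have "0 < m ^ (2 * m)" using m_pos by simp
  then have cS: "0 < card ?S" using card_instances_ge[OF fin V] by linarith
  have "of_nat (card ?S) * ?c \<le> of_nat (\<Sum>p\<in>?S. running_time G s A (len p))"
    if "A \<in> set_pmf R" for A
  proof -
    have "real (card ?S * m ^ 3) \<le> real (12 * (\<Sum>p\<in>?S. running_time G s A (len p)))"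
      using sum_running_time_ge[OF G s R[OF that] V] by (simp only: of_nat_le_iff)
    then have "real (card ?S) * (real m ^ 3 / 12) \<le> real (\<Sum>p\<in>?S. running_time G s A (len p))"
      by simp
    then have "ennreal (real (card ?S) * (real m ^ 3 / 12)) \<le> ennreal (real (\<Sum>p\<in>?S. running_time G s A (len p)))"
      by (rule ennreal_leI)
    then show ?thesis by (simp only: ennreal_mult' of_nat_0_le_iff ennreal_of_nat_eq_real_of_nat)
  qed
  \<comment> \<open>The averaged bound holds for every tree in the support of \<open>R\<close>,
    hence almost everywhere; integrating it and moving the finite sum outside leaves an average of
    expectations, which the largest one attains.\<close>
  then have "(\<integral>\<^sup>+ A. of_nat (card ?S) * ?c \<partial>measure_pmf R)
    \<le> (\<integral>\<^sup>+ A. of_nat (\<Sum>p\<in>?S. running_time G s A (len p)) \<partial>measure_pmf R)"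
    by (intro nn_integral_mono_AE) (simp add: AE_measure_pmf_iff)
  also have "\<dots> = (\<Sum>p\<in>?S. E p)"
    unfolding E_def of_nat_sum by (rule nn_integral_sum) simp
  finally have avg: "of_nat (card ?S) * ?c \<le> (\<Sum>p\<in>?S. E p)" by simp
  have ne: "E ` ?S \<noteq> {}" "finite (E ` ?S)" using cS finS by auto
  obtain p where p: "p \<in> ?S" "E p = Max (E ` ?S)" using Max_in[OF ne(2,1)] by auto
  have "(\<Sum>p\<in>?S. E p) \<le> of_nat (card ?S) * E p"
    using p(2) finS by (intro sum_bounded_above) simp
  with avg have "of_nat (card ?S) * ?c \<le> of_nat (card ?S) * E p" by (rule order_trans)
  then have "?c \<le> E p" using cS by (simp add: ennreal_mult_le_mult_iff)
  then show ?thesis using no_negative_cycle_len[of p] p(1) unfolding E_def instances_def by blast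
qed

end

section \<open>From the hidden path to all \<open>n\<close>\<close>

lemma exists_slow_weights:
  fixes G :: "nat pair_pre_digraph" and R :: "nat algorithm pmf"
  assumes G: "complete_digraph n (with_proj G)" and s: "s \<in> pverts G"
    and R: "\<forall>A\<in>set_pmf R. correct_algorithm G s A"
  shows "\<exists>l. no_negative_cycle G l \<and>
    ennreal (1 / 12000 * real n ^ 3) \<le> (\<integral>\<^sup>+ A. of_nat (running_time G s A l) \<partial>measure_pmf R)"
proof (cases "n < 5")
  case True
  \<comment> \<open>For small \<open>n\<close> the claimed bound is below \<open>1\<close>, which
    every running time reaches, even under zero weights.\<close>
  have "real n ^ 3 \<le> 5 ^ 3" using True by (intro power_mono) auto
  then have "ennreal (1 / 12000 * real n ^ 3) \<le> 1" by simp
  also have "1 = (\<integral>\<^sup>+ A. 1 \<partial>measure_pmf R)" by simp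
  also have "\<dots> \<le> (\<integral>\<^sup>+ A. of_nat (running_time G s A (\<lambda>_. 0)) \<partial>measure_pmf R)"
  proof (rule nn_integral_mono)
    fix A
    have "of_nat 1 \<le> (of_nat (running_time G s A (\<lambda>_. 0)) :: ennreal)"
      by (simp only: of_nat_le_iff) (simp add: running_time_def)
    then show "1 \<le> (of_nat (running_time G s A (\<lambda>_. 0)) :: ennreal)" by simp
  qed
  finally show ?thesis
    by (intro exI[of _ "\<lambda>_. 0"]) (simp add: no_negative_cycle_def walk_length_def)
next
  case False
  \<comment> \<open>Room is needed for \<open>2 * m\<close> vertices in \<open>V\<close>, as many
    outside it, and \<open>s\<close>; \<open>4 * m + 1 <= 5 * m <= n\<close> provides it. Since
    \<open>n <= 10 * m\<close>, the constant is \<open>1 / (12 * 10 ^ 3)\<close>.\<close>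
  define m where "m = n div 5"
  have m: "1 \<le> m" "5 * m \<le> n" "n \<le> 10 * m" using False unfolding m_def by presburger+
  have W: "finite (pverts G)" "card (pverts G) = n" using G complete_digraph_pair_def[of n G] by simp_all
  then have "2 * m \<le> card (pverts G - {s})" using s m by simp
  then obtain V where V: "V \<subseteq> pverts G - {s}" "card V = 2 * m" "finite V"
    by (rule obtain_subset_with_card_n)
  interpret hidden_path s V m using V m(1) by unfold_locales auto
  have "card (pverts G - insert s V) = n - card (insert s V)"
    using V s W by (subst card_Diff_subset) auto
  moreover have "card (insert s V) = 2 * m + 1" using V s_notin by simp
  ultimately have "2 * m \<le> card (pverts G - insert s V)" using m by simp
  then obtain l where l: "no_negative_cycle G l"
    "ennreal (real m ^ 3 / 12) \<le> (\<integral>\<^sup>+ A. of_nat (running_time G s A l) \<partial>measure_pmf R)"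
    using exists_slow_instance[OF G s] R V by fastforce
  have "real n ^ 3 \<le> (10 * real m) ^ 3" using m(3) by (intro power_mono) simp_all
  then have "ennreal (1 / 12000 * real n ^ 3) \<le> ennreal (real m ^ 3 / 12)"
    by (intro ennreal_leI) (simp add: power_mult_distrib)
  with l show ?thesis using order_trans by blast
qed

theorem theorem2:
  shows "(\<exists>c>0. \<forall>n\<ge>2. \<forall>G :: nat pair_pre_digraph. complete_digraph n (with_proj G) \<longrightarrow>
            (\<forall>s\<in>pverts G. \<forall>A. correct_algorithm G s A \<longrightarrow>
               (\<exists>l. no_negative_cycle G l \<and>
                    c * real n ^ 3 \<le> real (running_time G s A l))))
       \<and> (\<exists>c>0. \<forall>n\<ge>2. \<forall>G :: nat pair_pre_digraph. complete_digraph n (with_proj G) \<longrightarrow>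
            (\<forall>s\<in>pverts G. \<forall>R :: nat algorithm pmf.
               (\<forall>A\<in>set_pmf R. correct_algorithm G s A) \<longrightarrow>
               (\<exists>l. no_negative_cycle G l \<and>
                    ennreal (c * real n ^ 3)
                      \<le> (\<integral>\<^sup>+ A. of_nat (running_time G s A l) \<partial>measure_pmf R))))"
proof (intro conjI exI[of _ "1 / 12000 :: real"] allI impI ballI)
  fix n s A and G :: "nat pair_pre_digraph"
  assume "complete_digraph n (with_proj G)" "s \<in> pverts G" "correct_algorithm G s A"
  \<comment> \<open>A deterministic algorithm is the randomized one given by a point mass.\<close>
  then obtain l where l: "no_negative_cycle G l"
    "ennreal (1 / 12000 * real n ^ 3)
      \<le> (\<integral>\<^sup>+ A. of_nat (running_time G s A l) \<partial>measure_pmf (return_pmf A))"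
    using exists_slow_weights[of n G s "return_pmf A"] by auto
  then have "ennreal (1 / 12000 * real n ^ 3) \<le> ennreal (real (running_time G s A l))"
    by (simp add: ennreal_of_nat_eq_real_of_nat)
  then have "1 / 12000 * real n ^ 3 \<le> real (running_time G s A l)" by (subst (asm) ennreal_le_iff) auto
  then show "\<exists>l. no_negative_cycle G l \<and> 1 / 12000 * real n ^ 3 \<le> real (running_time G s A l)"
    using l(1) by blast
qed (use exists_slow_weights in auto)

end
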